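(* For any may-must argumentation $F \equiv (A, R, f_Q)$ and any may-must argumentation $F' \equiv (A, R, f_Q')$ over the same $A$ and $R$, if $F \sqsubseteq F'$ holds, then $\pmb{\Gamma}[F] \subseteq \pmb{\Gamma}[F']$ holds.
   Context: Labels are $\mathcal{L} = \{\textsf{in}, \textsf{out}, \textsf{undec}\}$; a labelling $\lambda$ is a partial function from arguments to $\mathcal{L}$, and $\Lambda^{B}$ denotes the labellings defined exactly on the set $B$. A may-must scale is a pair $(x_1, x_2)$ of natural numbers with $x_1 \leq x_2$ ($x_1$ the may- condition, $x_2$ the must- condition); a nuance tuple is a pair $Q = ((n_1, n_2), (m_1, m_2))$ of may-must scales, the first for acceptance, the second for rejection. A may-must argumentation (MMA) is a tuple $(A, R, f_Q)$ with $A$ a finite set of arguments, $R \subseteq A \times A$ an attack relation, and $f_Q$ assigning a nuance tuple to each $a \in A$. For $a \in A$, $\mathrm{pre}(a)$ is the set of attackers of $a$; for a labelling $\lambda$, $\#\textsf{out}$ (resp. $\#\textsf{in}$) is the number of attackers of $a$ on which $\lambda$ is defined with value $\textsf{out}$ (resp. $\textsf{in}$). With $f_Q(a) = ((n_1,n_2),(m_1,m_2))$, $a$ satisfies under $\lambda$: may-a iff $n_1 \leq \#\textsf{out}$; must-a iff $n_2 \leq \#\textsf{out}$; may$_s$-a iff $n_1 \leq \#\textsf{out} < n_2$; not-a iff $\#\textsf{out} < n_1$; and analogously may-r, must-r, may$_s$-r, not-r using $m_1, m_2$ and $\#\textsf{in}$. A labelling $\lambda$ designates $l \in \mathcal{L}$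 for $a$ in the MMA iff $\lambda$ is defined on every attacker of $a$ and: if $l = \textsf{in}$, $a$ satisfies may-a but not must-r; if $l = \textsf{out}$, $a$ satisfies may-r but not must-a; if $l = \textsf{undec}$, either $a$ satisfies must-a and must-r, or $a$ satisfies at least one of may$_s$-a and may$_s$-r, or $a$ satisfies not-a and not-r. An abstract dialectical framework (ADF) is a tuple $(A, R, C)$ where $C$ gives, for each $a \in A$, a function $C_a : \Lambda^{\mathrm{pre}(a)} \rightarrow \mathcal{L}$. An ADF $(A, R, C)$ is a concretisation of an MMA $(A, R, f_Q)$ iff for every $a \in A$ and every $\lambda \in \Lambda^{\mathrm{pre}(a)}$, $C_a(\lambda)$ is one of the labels that $\lambda$ designates for $a$ in the MMA; $\pmb{\Gamma}[F]$ is the set of all concretisations of the MMA $F$. For nuance tuples, $Q_1 \unlhd Q_2$ iff for each $i \in \{1,2\}$, the may- condition of the $i$-th scale of $Q_2$ is $\leq$ that of $Q_1$ and the must- condition of the $i$-th scale of $Q_1$ is $\leq$ that of $Q_2$ (i.e. $Q_2$ has smaller-or-equal may- conditions and larger-or-equal must- conditions). For MMAs $(A, R, f_Q)$ and $(A, R, f_Q')$, $(A,R,f_Q) \sqsubseteq (A,R,f_Q')$ iff $f_Q(a) \unlhd f_Q'(a)$ for every $a \in A$. *)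

theory Defs
  imports Main "HOL-Library.FuncSet"
begin

datatype label = In | Out | Undec

type_synonym 'a labelling = "'a \<rightharpoonup> label"

definition labellings_on :: "'a set \<Rightarrow> 'a labelling set" where
  "labellings_on B = {lab. dom lab = B}"

(* A scale is (may condition, must condition);
   a nuance tuple is (acceptance scale, rejection scale). *)
type_synonym scale = "nat \<times> nat"
type_synonym nuance = "scale \<times> scale"

definition scales :: "scale set" where
  "scales = {(x1, x2). x1 \<le> x2}"

definition nuances :: "nuance set" where
  "nuances = scales \<times> scales"

type_synonym 'a mma = "'a set \<times> ('a \<times> 'a) set \<times> ('a \<Rightarrow> nuance)"

(* Functions on a set are extensional (undefined outside it), so that equality in HOL
   is equality of functions on that set. *)
fun is_mma :: "'a mma \<Rightarrow> bool" where
  "is_mma (A, R, f) \<longleftrightarrow> finite A \<and> R \<subseteq> A \<times> A \<and> f \<in> A \<rightarrow>\<^sub>E nuances"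

definition pre :: "('a \<times> 'a) set \<Rightarrow> 'a \<Rightarrow> 'a set" where
  "pre R a = {b. (b, a) \<in> R}"

definition num :: "label \<Rightarrow> ('a \<times> 'a) set \<Rightarrow> 'a labelling \<Rightarrow> 'a \<Rightarrow> nat" where
  "num l R lab a = card {b \<in> pre R a. lab b = Some l}"

fun meets_may :: "scale \<Rightarrow> nat \<Rightarrow> bool" where
  "meets_may (x1, x2) k \<longleftrightarrow> x1 \<le> k"

fun meets_must :: "scale \<Rightarrow> nat \<Rightarrow> bool" where
  "meets_must (x1, x2) k \<longleftrightarrow> x2 \<le> k"

fun meets_may_s :: "scale \<Rightarrow> nat \<Rightarrow> bool" where
  "meets_may_s (x1, x2) k \<longleftrightarrow> x1 \<le> k \<and> k < x2"

fun meets_not :: "scale \<Rightarrow> nat \<Rightarrow> bool" where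
  "meets_not (x1, x2) k \<longleftrightarrow> k < x1"

fun may_a :: "'a mma \<Rightarrow> 'a labelling \<Rightarrow> 'a \<Rightarrow> bool" where
  "may_a (A, R, f) lab a \<longleftrightarrow> meets_may (fst (f a)) (num Out R lab a)"

fun must_a :: "'a mma \<Rightarrow> 'a labelling \<Rightarrow> 'a \<Rightarrow> bool" where
  "must_a (A, R, f) lab a \<longleftrightarrow> meets_must (fst (f a)) (num Out R lab a)"

fun may_s_a :: "'a mma \<Rightarrow> 'a labelling \<Rightarrow> 'a \<Rightarrow> bool" where
  "may_s_a (A, R, f) lab a \<longleftrightarrow> meets_may_s (fst (f a)) (num Out R lab a)"

fun not_a :: "'a mma \<Rightarrow> 'a labelling \<Rightarrow> 'a \<Rightarrow> bool" where
  "not_a (A, R, f) lab a \<longleftrightarrow> meets_not (fst (f a)) (num Out R lab a)"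

fun may_r :: "'a mma \<Rightarrow> 'a labelling \<Rightarrow> 'a \<Rightarrow> bool" where
  "may_r (A, R, f) lab a \<longleftrightarrow> meets_may (snd (f a)) (num In R lab a)"

fun must_r :: "'a mma \<Rightarrow> 'a labelling \<Rightarrow> 'a \<Rightarrow> bool" where
  "must_r (A, R, f) lab a \<longleftrightarrow> meets_must (snd (f a)) (num In R lab a)"

fun may_s_r :: "'a mma \<Rightarrow> 'a labelling \<Rightarrow> 'a \<Rightarrow> bool" where
  "may_s_r (A, R, f) lab a \<longleftrightarrow> meets_may_s (snd (f a)) (num In R lab a)"

fun not_r :: "'a mma \<Rightarrow> 'a labelling \<Rightarrow> 'a \<Rightarrow> bool" where
  "not_r (A, R, f) lab a \<longleftrightarrow> meets_not (snd (f a)) (num In R lab a)"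

fun attackers :: "'a mma \<Rightarrow> 'a \<Rightarrow> 'a set" where
  "attackers (A, R, f) a = pre R a"

definition designates :: "'a mma \<Rightarrow> 'a labelling \<Rightarrow> label \<Rightarrow> 'a \<Rightarrow> bool" where
  "designates F lab l a \<longleftrightarrow>
     attackers F a \<subseteq> dom lab \<and>
     (case l of
        In \<Rightarrow> may_a F lab a \<and> \<not> must_r F lab a
      | Out \<Rightarrow> may_r F lab a \<and> \<not> must_a F lab a
      | Undec \<Rightarrow> (must_a F lab a \<and> must_r F lab a) \<or>
                 (may_s_a F lab a \<or> may_s_r F lab a) \<or>
                 (not_a F lab a \<and> not_r F lab a))"

type_synonym 'a adf = "'a set \<times> ('a \<times> 'a) set \<times> ('a \<Rightarrow> 'a labelling \<Rightarrow> label)"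

fun is_adf :: "'a adf \<Rightarrow> bool" where
  "is_adf (A, R, C) \<longleftrightarrow> finite A \<and> R \<subseteq> A \<times> A \<and>
     C \<in> (\<Pi>\<^sub>E a\<in>A. labellings_on (pre R a) \<rightarrow>\<^sub>E UNIV)"

fun is_concretisation :: "'a adf \<Rightarrow> 'a mma \<Rightarrow> bool" where
  "is_concretisation (A', R', C) (A, R, f) \<longleftrightarrow>
     is_adf (A', R', C) \<and> A' = A \<and> R' = R \<and>
     (\<forall>a\<in>A. \<forall>lab\<in>labellings_on (pre R a). designates (A, R, f) lab (C a lab) a)"

definition concretisations :: "'a mma \<Rightarrow> 'a adf set" ("\<^bold>\<Gamma>[_]") where
  "\<^bold>\<Gamma>[F] = {D. is_concretisation D F}"

fun nuance_le :: "nuance \<Rightarrow> nuance \<Rightarrow> bool" (infix "\<unlhd>" 50) where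
  "((n1, n2), (m1, m2)) \<unlhd> ((n1', n2'), (m1', m2')) \<longleftrightarrow>
     n1' \<le> n1 \<and> n2 \<le> n2' \<and> m1' \<le> m1 \<and> m2 \<le> m2'"

fun mma_le :: "'a mma \<Rightarrow> 'a mma \<Rightarrow> bool" (infix "\<sqsubseteq>" 50) where
  "(A, R, f) \<sqsubseteq> (A', R', f') \<longleftrightarrow> A = A' \<and> R = R' \<and> (\<forall>a\<in>A. f a \<unlhd> f' a)"

end

theory Submission
  imports Defs
begin

text \<open>
  Enlarging a scale \<open>(x1, x2)\<close> only enlarges the interval \<open>{x1..<x2}\<close> of counts satisfying the
  strict may-condition, so a count that changes status can only move into it. Hence \<open>In\<close> and \<open>Out\<close>
  stay designated, and if the attackers justify \<open>Undec\<close> by two musts or two nots, then either both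
  statuses persist or one of them becomes a strict may, which again justifies \<open>Undec\<close>.
\<close>

lemma designates_mono:
  assumes "f a \<in> nuances" and "f a \<unlhd> f' a" and "designates (A, R, f) lab l a"
  shows "designates (A, R, f') lab l a"
proof -
  obtain n1 n2 m1 m2 where f: "f a = ((n1, n2), (m1, m2))"
    by (metis surj_pair)
  obtain n1' n2' m1' m2' where f': "f' a = ((n1', n2'), (m1', m2'))"
    by (metis surj_pair)
  \<comment> \<open>The order within a scale settles \<open>Undec\<close>: a count \<open>k\<close>
    that loses must still has \<open>n1' \<le> n1 \<le> n2 \<le> k\<close>, and one that loses not
    has \<open>k < n1 \<le> n2 \<le> n2'\<close>, so either becomes a strict may; likewise for
    rejection.\<close>
  have "n1 \<le> n2" "m1 \<le> m2"
    using assms(1) by (auto simp: f nuances_def scales_def)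
  moreover have "n1' \<le> n1" "n2 \<le> n2'" "m1' \<le> m1" "m2 \<le> m2'"
    using assms(2) by (auto simp: f f')
  ultimately show ?thesis
    using assms(3) by (cases l) (auto simp: designates_def f f')
qed

theorem mainTheorem2:
  fixes A :: "'a set" and R :: "('a \<times> 'a) set" and f f' :: "'a \<Rightarrow> nuance"
  assumes "is_mma (A, R, f)"
    and "is_mma (A, R, f')"
    and "(A, R, f) \<sqsubseteq> (A, R, f')"
  shows "\<^bold>\<Gamma>[(A, R, f)] \<subseteq> \<^bold>\<Gamma>[(A, R, f')]"
proof -
  have "designates (A, R, f') lab l a" if "a \<in> A" "designates (A, R, f) lab l a" for lab l a
    using assms that by (intro designates_mono[of f a f']) (auto simp: PiE_def)
  \<comment> \<open>Being an ADF over \<open>A\<close> and \<open>R\<close> does not depend on the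
    nuance tuples, so \<open>is_adf\<close> stays folded and carries over unchanged; what remains is
    the pointwise designation condition.\<close>
  then show ?thesis
    by (auto simp: concretisations_def simp del: is_adf.simps)
qed

end
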